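(* Let $A\in\mathbb{R}^{2\times 2}$ be symmetric positive definite, $b\in\mathbb{R}^2$, and $q(x)=\frac12 x^{T}Ax+b^{T}x$ for $x\in\mathbb{R}^2$. Write $g_k=\nabla q(x_k)$, and consider the subspace minimization conjugate gradient iteration with unit stepsizes $x_{k+1}=x_k+d_k$, run as long as $g_k\neq 0$, where the first direction is $d_0=-\alpha_0 g_0$ with $\alpha_0$ the exact (Cauchy) stepsize, i.e. $\alpha_0$ minimizes $\alpha\mapsto q(x_0-\alpha g_0)$, and for $k\ge 1$, $d_k=u_kg_k+v_ks_{k-1}$ with $u_k,v_k$ as defined in the context and with scaling parameter $\tau_k=1$. Then, for any starting point $x_0\in\mathbb{R}^2$, one must have $g_j=0$ for some $j\le 3$.
   Context: Notation: $s_{k-1}=x_k-x_{k-1}$, $y_{k-1}=g_k-g_{k-1}$, $\|\cdot\|$ is the Euclidean norm, and $$\overline\omega_k=\frac{(g_k^Ts_{k-1})^2}{\|g_k\|^2\|s_{k-1}\|^2}.$$ For a scaling parameter $\tau_k>0$, the coefficients of the direction are $$u_k=\frac{1}{1-\overline\omega_k}\left(-1+\frac{g_k^Ty_{k-1}\,g_k^Ts_{k-1}}{s_{k-1}^Ty_{k-1}\|g_k\|^2}\right),$$ $$v_k=\frac{1-2\overline\omega_k}{1-\overline\omega_k}\,\frac{g_k^Ty_{k-1}}{s_{k-1}^Ty_{k-1}}-\left(\tau_k+\frac{\|y_{k-1}\|^2}{s_{k-1}^Ty_{k-1}}-\frac{s_{k-1}^Ty_{k-1}}{(1-\overline\omega_k)\|s_{k-1}\|^2}\right)\frac{g_k^Ts_{k-1}}{s_{k-1}^Ty_{k-1}}.$$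 *)

theory Defs
  imports "HOL-Analysis.Analysis"
begin

definition sym_pos_def :: "real^'n^'n \<Rightarrow> bool" where
  "sym_pos_def A \<longleftrightarrow> transpose A = A \<and> (\<forall>z. z \<noteq> 0 \<longrightarrow> 0 < z \<bullet> (A *v z))"

definition quadratic :: "real^'n^'n \<Rightarrow> real^'n \<Rightarrow> real^'n \<Rightarrow> real" where
  "quadratic A b z = 1/2 * (z \<bullet> (A *v z)) + b \<bullet> z"

(* In the three definitions below the vector arguments are
   g = g_k,  s = s_{k-1} = x_k - x_{k-1},  y = y_{k-1} = g_k - g_{k-1},
   and \<tau> is the scaling parameter \<tau>_k.  The quotients are meaningful when
   g and s are nonzero and not parallel (so that omega_bar g s < 1) and s \<bullet> y is nonzero;
   otherwise HOL's convention a / 0 = 0 applies. *)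

definition omega_bar :: "'a::real_inner \<Rightarrow> 'a \<Rightarrow> real" where
  "omega_bar g s = (g \<bullet> s)\<^sup>2 / ((norm g)\<^sup>2 * (norm s)\<^sup>2)"

definition u_coeff :: "'a::real_inner \<Rightarrow> 'a \<Rightarrow> 'a \<Rightarrow> real" where
  "u_coeff g s y =
     1 / (1 - omega_bar g s) * (- 1 + ((g \<bullet> y) * (g \<bullet> s)) / ((s \<bullet> y) * (norm g)\<^sup>2))"

definition v_coeff :: "real \<Rightarrow> 'a::real_inner \<Rightarrow> 'a \<Rightarrow> 'a \<Rightarrow> real" where
  "v_coeff \<tau> g s y =
     (1 - 2 * omega_bar g s) / (1 - omega_bar g s) * ((g \<bullet> y) / (s \<bullet> y))
     - (\<tau> + (norm y)\<^sup>2 / (s \<bullet> y) - (s \<bullet> y) / ((1 - omega_bar g s) * (norm s)\<^sup>2))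
       * ((g \<bullet> s) / (s \<bullet> y))"

end

theory Submission
  imports Defs
begin

text \<open>
  The Cauchy step makes \<open>g\<^sub>1\<close> orthogonal to \<open>s\<^sub>0\<close>, and with exact orthogonality the
  direction \<open>u\<^sub>1 g\<^sub>1 + v\<^sub>1 s\<^sub>0\<close> is the linear conjugate gradient direction, so
  \<open>A d\<^sub>1\<close> is orthogonal to \<open>s\<^sub>0\<close> as well (lemmas \<open>coeffs_orthogonal\<close>,
  \<open>cg_direction_conjugate\<close>).  In the plane the vectors orthogonal to \<open>s\<^sub>0\<close> form a line; hence
  \<open>y\<^sub>1 = A d\<^sub>1 = \<mu> g\<^sub>1\<close>: the second step runs along the line through the minimizer of
  \<open>q\<close>, and only its length may be wrong.  In particular \<open>g\<^sub>2 = (1 + \<mu>) g\<^sub>1\<close> is parallel to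
  \<open>y\<^sub>1\<close>.

  When \<open>y = r g\<close>, the coefficients collapse to \<open>u = 0\<close> and \<open>v = - \<tau> / r\<close>
  (lemma \<open>coeffs_parallel\<close>).  With \<open>\<tau> = 1\<close> this gives
  \<open>A d\<^sub>2 = - y\<^sub>1 / r = - g\<^sub>2\<close>, so the third step lands on the minimizer.

  The collapse needs \<open>\<omega> \<noteq> 1\<close>, that is, \<open>s\<^sub>1 = d\<^sub>1\<close> not parallel to \<open>g\<^sub>2\<close> or, equally, to
  \<open>g\<^sub>1\<close>.
  This holds because \<open>d\<^sub>1\<close> has a nonzero component along \<open>s\<^sub>0\<close>: its coefficient is
  \<open>g\<^sub>1 \<bullet> y\<^sub>0 / (s\<^sub>0 \<bullet> y\<^sub>0)\<close>, and \<open>g\<^sub>1 \<bullet> y\<^sub>0 = (norm g\<^sub>1)\<^sup>2\<close> since \<open>g\<^sub>1\<close> is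
  orthogonal to \<open>g\<^sub>0\<close>.
\<close>

section \<open>Quadratic functions with symmetric Hessian\<close>

lemma symmetric_inner_commute:
  fixes A :: "real^'n^'n"
  assumes "transpose A = A"
  shows "v \<bullet> (A *v w) = w \<bullet> (A *v v)"
  by (metis assms dot_lmul_matrix inner_commute transpose_matrix_vector)

lemma quadratic_add:
  fixes A :: "real^'n^'n"
  assumes "transpose A = A"
  shows "quadratic A b (z + h) = quadratic A b z + (A *v z + b) \<bullet> h + 1/2 * (h \<bullet> (A *v h))"
  using symmetric_inner_commute[OF assms, of z h]
  by (simp add: quadratic_def matrix_vector_right_distrib inner_add inner_commute[of h "A *v z"]
      algebra_simps)

lemma GDERIV_quadratic:
  fixes A :: "real^'n^'n"
  assumes "transpose A = A"
  shows "GDERIV (quadratic A b) z :> A *v z + b"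
proof -
  have "((\<lambda>z. 1/2 * (z \<bullet> (A *v z)) + b \<bullet> z) has_derivative
      (\<lambda>h. 1/2 * (z \<bullet> (A *v h) + h \<bullet> (A *v z)) + b \<bullet> h)) (at z)"
    by (intro derivative_intros bounded_linear.has_derivative[OF matrix_vector_mul_bounded_linear])
  moreover have "(\<lambda>h. 1/2 * (z \<bullet> (A *v h) + h \<bullet> (A *v z)) + b \<bullet> h) = (\<lambda>h. h \<bullet> (A *v z + b))"
    using symmetric_inner_commute[OF assms, of z]
    by (simp add: fun_eq_iff inner_add inner_commute)
  ultimately show ?thesis
    by (simp add: gderiv_def quadratic_def[abs_def])
qed

lemma GDERIV_quadratic_eq:
  fixes A :: "real^'n^'n"
  assumes "transpose A = A" "GDERIV (quadratic A b) z :> g"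
  shows "g = A *v z + b"
proof -
  have "(\<lambda>h. h \<bullet> g) = (\<lambda>h. h \<bullet> (A *v z + b))"
    using has_derivative_unique assms(2) GDERIV_quadratic[OF assms(1)]
    unfolding gderiv_def by blast
  then show ?thesis
    by (metis vector_eq_ldot)
qed

text \<open>
  At an exact minimizer \<open>\<alpha>\<close> along a line, moving on by \<open>t\<close> changes \<open>q\<close> by
  \<open>- t p + t\<^sup>2 c / 2\<close>, where \<open>p\<close> is the slope and \<open>c\<close> the curvature along the line.
  If \<open>p \<noteq> 0\<close>, the choice \<open>t = p / c\<close> would make this negative.
\<close>

lemma exact_line_search_orthogonal:
  fixes A :: "real^'n^'n"
  assumes spd: "sym_pos_def A"
    and min: "is_arg_min (\<lambda>\<alpha>. quadratic A b (z - \<alpha> *\<^sub>R e)) (\<lambda>\<alpha>. True) \<alpha>"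
  shows "(A *v (z - \<alpha> *\<^sub>R e) + b) \<bullet> e = 0"
proof (cases "e = 0")
  case False
  define w where "w = z - \<alpha> *\<^sub>R e"
  define p where "p = (A *v w + b) \<bullet> e"
  define c where "c = e \<bullet> (A *v e)"
  have "c > 0"
    using spd False by (simp add: sym_pos_def_def c_def)
  have expand: "quadratic A b (w + t *\<^sub>R e) = quadratic A b w + t * p + 1/2 * (t\<^sup>2 * c)" for t
    using spd
    by (subst quadratic_add)
      (auto simp: sym_pos_def_def p_def c_def matrix_vector_mult_scaleR power2_eq_square)
  have "quadratic A b w \<le> quadratic A b (z - (\<alpha> + p / c) *\<^sub>R e)"
    using min by (simp add: is_arg_min_linorder w_def)
  also have "z - (\<alpha> + p / c) *\<^sub>R e = w + (- (p / c)) *\<^sub>R e"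
    by (simp add: w_def algebra_simps)
  also have "quadratic A b \<dots> = quadratic A b w + - (p / c) * p + 1/2 * ((- (p / c))\<^sup>2 * c)"
    by (rule expand)
  also have "\<dots> = quadratic A b w - p\<^sup>2 / (2 * c)"
    using \<open>c > 0\<close> by (simp add: field_simps power2_eq_square)
  finally have "p\<^sup>2 / (2 * c) \<le> 0"
    by simp
  then have "p = 0"
    using \<open>c > 0\<close> by (simp add: divide_le_0_iff)
  then show ?thesis
    by (simp add: p_def w_def)
qed simp

section \<open>Two degenerate positions of the direction coefficients\<close>

lemma coeffs_orthogonal:
  assumes "g \<bullet> s = 0"
  shows "u_coeff g s y = - 1" "v_coeff \<tau> g s y = (g \<bullet> y) / (s \<bullet> y)"
  using assms by (simp_all add: u_coeff_def v_coeff_def omega_bar_def)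

lemma cg_direction_conjugate:
  fixes g s y :: "'a::real_inner"
  assumes "s \<bullet> y \<noteq> 0"
  shows "(- g + ((g \<bullet> y) / (s \<bullet> y)) *\<^sub>R s) \<bullet> y = 0"
  using assms by (simp add: inner_diff_left)

text \<open>
  The curvature terms cancel because \<open>(g \<bullet> s) / (norm s)\<^sup>2 = \<omega> (norm g)\<^sup>2 / (g \<bullet> s)\<close> by
  definition of \<open>\<omega>\<close>: the three contributions to \<open>v\<close> that do not carry \<open>\<tau>\<close> are multiples
  of \<open>(norm g)\<^sup>2 / (g \<bullet> s)\<close> by \<open>(1 - 2 \<omega>) / (1 - \<omega>)\<close>, \<open>- 1\<close> and \<open>\<omega> / (1 - \<omega>)\<close>,
  which sum to zero.
\<close>

lemma coeffs_parallel:
  assumes y: "y = r *\<^sub>R g" and r: "r \<noteq> 0"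
    and gs: "g \<bullet> s \<noteq> 0" and \<omega>: "omega_bar g s \<noteq> 1"
  shows "u_coeff g s y = 0" "v_coeff \<tau> g s y = - (\<tau> / r)"
proof -
  define w where "w = omega_bar g s"
  define G where "G = (norm g)\<^sup>2"
  define S where "S = (norm s)\<^sup>2"
  define p where "p = g \<bullet> s"
  have nz: "G \<noteq> 0" "S \<noteq> 0" "p \<noteq> 0" "1 - w \<noteq> 0"
    using gs \<omega> by (auto simp: G_def S_def p_def w_def)
  have gy: "g \<bullet> y = r * G" and sy: "s \<bullet> y = r * p" and yy: "(norm y)\<^sup>2 = r\<^sup>2 * G"
    by (simp_all add: y G_def p_def power_mult_distrib inner_commute[of s g]
        flip: power2_norm_eq_inner)
  show "u_coeff g s y = 0"
    using nz r by (simp add: u_coeff_def gy sy G_def[symmetric] p_def[symmetric])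
  have "p\<^sup>2 = w * G * S"
    using nz by (simp add: w_def omega_bar_def G_def S_def p_def)
  then have pS: "p / S = w * G / p"
    using nz by (simp add: field_simps power2_eq_square)
  have "v_coeff \<tau> g s y =
      (1 - 2 * w) / (1 - w) * (G / p) - (\<tau> + r * (G / p) - r / (1 - w) * (p / S)) / r"
    unfolding v_coeff_def gy sy yy G_def[symmetric] S_def[symmetric] p_def[symmetric]
      w_def[symmetric]
    using nz r by (simp add: power2_eq_square)
  also have "\<dots> = ((1 - 2 * w) / (1 - w) - 1 + w / (1 - w)) * (G / p) - \<tau> / r"
    unfolding pS using nz r by (simp add: divide_simps) (simp add: algebra_simps)
  also have "(1 - 2 * w) / (1 - w) - 1 + w / (1 - w) = 0"
    using nz by (simp add: field_simps)
  finally show "v_coeff \<tau> g s y = - (\<tau> / r)"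
    by simp
qed

section \<open>Planar geometry\<close>

lemma orthogonal_complement_line_R2:
  fixes e v w :: "real^2"
  assumes "e \<noteq> 0" "v \<noteq> 0" "v \<bullet> e = 0" "w \<bullet> e = 0"
  obtains c where "w = c *\<^sub>R v"
proof -
  have v: "v$1 * e$1 + v$2 * e$2 = 0" and w: "w$1 * e$1 + w$2 * e$2 = 0"
    using assms by (simp_all add: inner_vec_def sum_2)
  have "e$1 \<noteq> 0 \<or> e$2 \<noteq> 0" "v$1 \<noteq> 0 \<or> v$2 \<noteq> 0"
    using assms by (auto simp: vec_eq_iff forall_2)
  moreover have "e$1 * (v$1 * w$2 - v$2 * w$1) = 0" "e$2 * (v$1 * w$2 - v$2 * w$1) = 0"
    using v w by algebra+
  ultimately have det: "v$1 * w$2 = v$2 * w$1"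
    by auto
  show thesis
  proof (cases "v$1 = 0")
    case True
    then have "w = (w$2 / v$2) *\<^sub>R v"
      using det \<open>v$1 \<noteq> 0 \<or> v$2 \<noteq> 0\<close> by (auto simp: vec_eq_iff forall_2)
    then show thesis by (rule that)
  next
    case False
    then have "w = (w$1 / v$1) *\<^sub>R v"
      using det by (auto simp: vec_eq_iff forall_2 field_simps)
    then show thesis by (rule that)
  qed
qed

text \<open>
  Up to the factor \<open>t\<close>, \<open>omega_bar\<close> is the squared cosine between \<open>g\<close> and a vector whose
  component orthogonal to \<open>g\<close> is \<open>\<beta> s \<noteq> 0\<close>, so Pythagoras makes it strictly less than one.
\<close>

lemma omega_bar_orthogonal_sum_neq_1:
  assumes "g \<bullet> s = 0" "g \<noteq> 0" "s \<noteq> 0" "\<beta> \<noteq> 0" "t \<noteq> 0"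
  shows "omega_bar (t *\<^sub>R g) (- g + \<beta> *\<^sub>R s) \<noteq> 1"
proof
  assume "omega_bar (t *\<^sub>R g) (- g + \<beta> *\<^sub>R s) = 1"
  moreover have "(norm (- g + \<beta> *\<^sub>R s))\<^sup>2 = g \<bullet> g + \<beta>\<^sup>2 * (s \<bullet> s)"
    using assms
    unfolding power2_norm_eq_inner
    by (simp add: inner_diff inner_commute[of s g] power2_eq_square)
  moreover have "t *\<^sub>R g \<bullet> (- g + \<beta> *\<^sub>R s) = - t * (g \<bullet> g)"
    using assms by (simp add: inner_diff)
  moreover have "(norm (t *\<^sub>R g))\<^sup>2 = t\<^sup>2 * (g \<bullet> g)"
    unfolding power2_norm_eq_inner by (simp add: power2_eq_square)
  ultimately have "(- t * (g \<bullet> g))\<^sup>2 / (t\<^sup>2 * (g \<bullet> g) * (g \<bullet> g + \<beta>\<^sup>2 * (s \<bullet> s))) = 1"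
    by (simp add: omega_bar_def)
  then have "(- t * (g \<bullet> g))\<^sup>2 = t\<^sup>2 * (g \<bullet> g) * (g \<bullet> g + \<beta>\<^sup>2 * (s \<bullet> s))"
    by (simp only: divide_eq_1_iff)
  then have "t\<^sup>2 * (g \<bullet> g) * (g \<bullet> g) = t\<^sup>2 * (g \<bullet> g) * (g \<bullet> g + \<beta>\<^sup>2 * (s \<bullet> s))"
    by (simp add: power2_eq_square mult_ac)
  then show False
    using assms by simp
qed

section \<open>Termination of the iteration\<close>

theorem theorem2p1:
  fixes A :: "real^2^2" and b :: "real^2"
    and x g d s y :: "nat \<Rightarrow> real^2"
    and \<alpha>\<^sub>0 :: real and \<tau> :: "nat \<Rightarrow> real"
  assumes spd: "sym_pos_def A"
    and grad: "\<And>k. GDERIV (quadratic A b) (x k) :> g k"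
    and s_eq: "\<And>k. s k = x (Suc k) - x k"
    and y_eq: "\<And>k. y k = g (Suc k) - g k"
    and tau: "\<And>k. k \<ge> 1 \<Longrightarrow> \<tau> k = 1"
    and cauchy: "is_arg_min (\<lambda>\<alpha>. quadratic A b (x 0 - \<alpha> *\<^sub>R g 0)) (\<lambda>\<alpha>. True) \<alpha>\<^sub>0"
    and d_0: "d 0 = - \<alpha>\<^sub>0 *\<^sub>R g 0"
    and d_k: "\<And>k. k \<ge> 1 \<Longrightarrow> (\<forall>i\<le>k. g i \<noteq> 0) \<Longrightarrow>
      d k = u_coeff (g k) (s (k - 1)) (y (k - 1)) *\<^sub>R g k
          + v_coeff (\<tau> k) (g k) (s (k - 1)) (y (k - 1)) *\<^sub>R s (k - 1)"
    and step: "\<And>k. (\<forall>i\<le>k. g i \<noteq> 0) \<Longrightarrow> x (Suc k) = x k + d k"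
  shows "\<exists>j\<le>3. g j = 0"
proof (rule ccontr)
  assume "\<not> ?thesis"
  then have g_nz: "g j \<noteq> 0" if "j \<le> 3" for j
    using that by blast
  have symA: "transpose A = A" and pos: "\<And>z. z \<noteq> 0 \<Longrightarrow> 0 < z \<bullet> (A *v z)"
    using spd by (auto simp: sym_pos_def_def)
  have g_eq: "g k = A *v x k + b" for k
    using GDERIV_quadratic_eq[OF symA grad] .
  have y_As: "y k = A *v s k" for k
    by (simp add: y_eq s_eq g_eq matrix_vector_mult_diff_distrib)
  have s_d: "s k = d k" if "k \<le> 2" for k
    using step[of k] g_nz that by (simp add: s_eq)

  have s0: "s 0 = - \<alpha>\<^sub>0 *\<^sub>R g 0"
    using s_d[of 0] d_0 by simp
  have x1: "x 1 = x 0 - \<alpha>\<^sub>0 *\<^sub>R g 0"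
    using s0 s_eq[of 0] by (simp add: algebra_simps)
  have g1_g0: "g 1 \<bullet> g 0 = 0"
    using exact_line_search_orthogonal[OF spd cauchy] by (simp only: g_eq[of 1] x1)
  then have g1_s0: "g 1 \<bullet> s 0 = 0"
    by (simp add: s0)
  have g1_y0: "g 1 \<bullet> y 0 = g 1 \<bullet> g 1"
    using g1_g0 by (simp add: y_eq inner_diff)
  have "s 0 \<noteq> 0"
  proof
    assume "s 0 = 0"
    then have "g 1 = g 0"
      using y_As[of 0] y_eq[of 0] by simp
    then show False
      using g1_g0 g_nz[of 0] by simp
  qed
  then have s0_y0: "s 0 \<bullet> y 0 \<noteq> 0"
    using pos[of "s 0"] by (simp add: y_As)

  define \<beta> where "\<beta> = (g 1 \<bullet> y 0) / (s 0 \<bullet> y 0)"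
  have "\<beta> \<noteq> 0"
    using s0_y0 g1_y0 g_nz[of 1] by (simp add: \<beta>_def)
  have d1: "d 1 = - g 1 + \<beta> *\<^sub>R s 0"
    using d_k[of 1] g_nz coeffs_orthogonal[OF g1_s0] by (simp add: \<beta>_def)
  have "d 1 \<bullet> y 0 = 0"
    unfolding d1 \<beta>_def by (rule cg_direction_conjugate[OF s0_y0])
  \<comment> \<open>Conjugacy is symmetric: \<open>d\<^sub>1 \<bullet> A s\<^sub>0 = 0\<close> also says that \<open>y\<^sub>1 = A d\<^sub>1\<close> is orthogonal to \<open>s\<^sub>0\<close>.\<close>
  then have "y 1 \<bullet> s 0 = 0"
    using symmetric_inner_commute[OF symA, of "d 1" "s 0"] s_d[of 1]
    by (simp add: y_As inner_commute)
  then obtain \<mu> where y1: "y 1 = \<mu> *\<^sub>R g 1"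
    using orthogonal_complement_line_R2[OF \<open>s 0 \<noteq> 0\<close> g_nz[of 1] g1_s0] by auto

  have g2: "g 2 = (1 + \<mu>) *\<^sub>R g 1"
    using y1 y_eq[of 1] by (simp add: algebra_simps numeral_2_eq_2)
  then have t: "1 + \<mu> \<noteq> 0"
    using g_nz[of 2] by auto
  have g1_s1: "g 1 \<bullet> s 1 \<noteq> 0"
    using s_d[of 1] d1 g1_s0 g_nz[of 1] by (simp add: inner_diff)
  have "\<mu> \<noteq> 0"
  proof
    assume "\<mu> = 0"
    then have "s 1 \<bullet> (A *v s 1) = 0"
      using y1 y_As[of 1] by simp
    then show False
      using pos[of "s 1"] g1_s1 by fastforce
  qed

  define r where "r = \<mu> / (1 + \<mu>)"
  have "r \<noteq> 0"
    using \<open>\<mu> \<noteq> 0\<close> t by (simp add: r_def)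
  have y1_g2: "y 1 = r *\<^sub>R g 2"
    using t unfolding y1 g2 r_def by simp
  have "g 2 \<bullet> s 1 \<noteq> 0"
    using g2 t g1_s1 by simp
  moreover have "omega_bar (g 2) (s 1) \<noteq> 1"
    using omega_bar_orthogonal_sum_neq_1[OF g1_s0 g_nz[of 1] \<open>s 0 \<noteq> 0\<close> \<open>\<beta> \<noteq> 0\<close> t]
      s_d[of 1] d1 g2 by simp
  ultimately have "d 2 = - (1 / r) *\<^sub>R s 1"
    using d_k[of 2] g_nz coeffs_parallel[OF y1_g2 \<open>r \<noteq> 0\<close>, of "s 1"] tau[of 2] by simp
  then have "y 2 = - (1 / r) *\<^sub>R y 1"
    using s_d[of 2] by (simp add: y_As matrix_vector_mult_scaleR flip: scaleR_minus_left)
  then have "g 3 - g 2 = - g 2"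
    using y_eq[of 2] y1_g2 \<open>r \<noteq> 0\<close> by (simp add: numeral_3_eq_3 numeral_2_eq_2)
  then show False
    using g_nz[of 3] by simp
qed

end
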